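(* Let $b$ be a positive integer and let $a$ be a real number with $0<a<b+1$. Then the following hold for the improper integral $I=\int_0^{+\infty}\frac{\sin^b x}{x^a}\,dx$. (i) If $a>1$, then $I$ converges. (ii) If $0<a\le 1$, then $I$ converges when $b$ is odd, and $I$ diverges when $b$ is even.
   Context: Here $\int_0^{+\infty} f(x)\,dx$ is understood as an improper Riemann integral at both ends: it converges if both $\lim_{\varepsilon\to 0^+}\int_\varepsilon^1 f(x)\,dx$ and $\lim_{R\to+\infty}\int_1^R f(x)\,dx$ exist and are finite, and it diverges otherwise (conditional convergence is allowed). *)

theory Defs
  imports "HOL-Analysis.Analysis"
begin

text \<open>
  The library's \<^const>\<open>integral\<close> is the Henstock--Kurzweil integral, whose gauges may vary from
  point to point; the Riemann integral bounds the mesh uniformly. In dimension one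
  \<^term>\<open>measure lborel K\<close> is the length of the interval \<^term>\<open>K\<close>.
\<close>

definition has_riemann_integral :: "(real \<Rightarrow> real) \<Rightarrow> real \<Rightarrow> real \<Rightarrow> real \<Rightarrow> bool" where
  "has_riemann_integral f a b I \<longleftrightarrow>
     (\<forall>\<epsilon>>0. \<exists>\<delta>>0. \<forall>D. D tagged_division_of {a..b} \<and> (\<forall>(x, K)\<in>D. measure lborel K < \<delta>) \<longrightarrow>
        \<bar>(\<Sum>(x, K)\<in>D. measure lborel K * f x) - I\<bar> < \<epsilon>)"

text \<open>
  The functions \<^term>\<open>F\<close> and \<^term>\<open>G\<close> collect the values of the proper integrals, so that their
  existence is part of convergence. The value of \<^term>\<open>f\<close> at \<open>0\<close> is irrelevant.
\<close>

definition improper_riemann_convergent :: "(real \<Rightarrow> real) \<Rightarrow> bool" where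
  "improper_riemann_convergent f \<longleftrightarrow>
     (\<exists>F L. (\<forall>\<epsilon>. 0 < \<epsilon> \<and> \<epsilon> \<le> 1 \<longrightarrow> has_riemann_integral f \<epsilon> 1 (F \<epsilon>)) \<and>
            (F \<longlongrightarrow> L) (at_right 0)) \<and>
     (\<exists>G M. (\<forall>R\<ge>1. has_riemann_integral f 1 R (G R)) \<and> (G \<longlongrightarrow> M) at_top)"

abbreviation improper_riemann_divergent :: "(real \<Rightarrow> real) \<Rightarrow> bool" where
  "improper_riemann_divergent f \<equiv> \<not> improper_riemann_convergent f"

end

theory Submission
  imports Defs
begin

text \<open>
  By the reduction formula \<open>sin\<^sup>n = c + P'\<close> with \<open>P\<close> bounded, where \<open>c\<close> (the mean of \<open>sin\<^sup>n\<close>) is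
  \<open>0\<close> for odd \<open>n\<close> and positive for even \<open>n\<close>. Integrating \<open>P' x\<^sup>-\<^sup>a\<close> by parts leaves the absolutely
  convergent integral of \<open>P x\<^sup>-\<^sup>a\<^sup>-\<^sup>1\<close>, so at infinity the integral behaves like \<open>c \<integral> x\<^sup>-\<^sup>a\<close>.
  Near \<open>0\<close> the integrand is dominated by \<open>x\<^sup>b\<^sup>-\<^sup>a\<close>, and \<open>b - a > -1\<close>.
\<close>

section \<open>Riemann and Henstock--Kurzweil integrals\<close>

text \<open>A uniform mesh bound is a special gauge, namely balls of constant radius, so the Riemann
  condition supplies the gauge that the Henstock--Kurzweil integral asks for.\<close>

lemma has_riemann_integral_imp_has_integral:
  assumes "has_riemann_integral f a b I"
  shows "(f has_integral I) {a..b}"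
  unfolding has_integral_real
proof (intro allI impI)
  fix e :: real assume "e > 0"
  then obtain d where d: "d > 0" and
    D: "\<forall>D. D tagged_division_of {a..b} \<and> (\<forall>(x, K)\<in>D. measure lborel K < d) \<longrightarrow>
        \<bar>(\<Sum>(x, K)\<in>D. measure lborel K * f x) - I\<bar> < e"
    using assms unfolding has_riemann_integral_def by blast
  \<comment> \<open>Both endpoints of a cell lie within \<open>d/3\<close> of its tag, so its length
    is below \<open>2*d/3\<close>, hence below \<open>d\<close>.\<close>
  have small: "measure lborel K < d"
    if p: "p tagged_division_of {a..b}" and fine: "(\<lambda>x. ball x (d/3)) fine p" and xK: "(x, K) \<in> p"
    for p x K
  proof -
    obtain u v where K: "K = cbox u v" using tagged_division_ofD(4)[OF p xK] by blast
    have "x \<in> K" using tagged_division_ofD(2)[OF p xK] .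
    then have "u \<le> v" using K by auto
    moreover have "K \<subseteq> ball x (d/3)" using fine xK by (auto simp: fine_def)
    ultimately have "dist x u < d/3" "dist x v < d/3" using K by auto
    then have "v - u < d" unfolding dist_real_def using d by linarith
    then show ?thesis using \<open>u \<le> v\<close> K by simp
  qed
  show "\<exists>\<gamma>. gauge \<gamma> \<and> (\<forall>\<D>. \<D> tagged_division_of {a..b} \<and> \<gamma> fine \<D> \<longrightarrow>
        norm ((\<Sum>(x, k)\<in>\<D>. measure lborel k *\<^sub>R f x) - I) < e)"
  proof (intro exI conjI allI impI)
    show "gauge (\<lambda>x. ball x (d/3))" using d by (intro gauge_ball) auto
    fix p assume "p tagged_division_of {a..b} \<and> (\<lambda>x. ball x (d/3)) fine p"
    then show "norm ((\<Sum>(x, k)\<in>p. measure lborel k *\<^sub>R f x) - I) < e"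
      using D small[of p] by auto
  qed
qed

text \<open>By uniform continuity a single mesh bound keeps the oscillation of \<open>f\<close> on
  every cell below \<open>e / C\<close>. The error on a cell is then at most \<open>e / C\<close>
  times its length, and the lengths add up to that of the interval.\<close>

lemma continuous_imp_has_riemann_integral:
  assumes cont: "continuous_on {a..b} f"
  shows "has_riemann_integral f a b (integral {a..b} f)"
  unfolding has_riemann_integral_def
proof (intro allI impI)
  fix e :: real assume e: "e > 0"
  \<comment> \<open>The summand 1 keeps \<open>C\<close> positive even for an empty or degenerate
    interval and makes the final estimate strict.\<close>
  define C where "C = measure lborel {a..b} + 1"
  have C: "C > 0" unfolding C_def by (smt (verit) measure_nonneg)
  have "uniformly_continuous_on {a..b} f"
    using cont by (intro compact_uniformly_continuous) auto
  then obtain d where d: "d > 0" and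
    uc: "\<And>x y. x \<in> {a..b} \<Longrightarrow> y \<in> {a..b} \<Longrightarrow> dist y x < d \<Longrightarrow> dist (f y) (f x) < e / C"
    unfolding uniformly_continuous_on_def using e C by (metis divide_pos_pos)
  have int: "f integrable_on cbox a b" using cont by (intro integrable_continuous) auto
  have "\<bar>(\<Sum>(x, K)\<in>D. measure lborel K * f x) - integral {a..b} f\<bar> < e"
    if p: "D tagged_division_of {a..b}" and small: "\<forall>(x, K)\<in>D. measure lborel K < d" for D
  proof -
    have p': "D tagged_division_of (cbox a b)" using p by simp
    have each: "\<bar>measure lborel K * f x - integral K f\<bar> \<le> e / C * measure lborel K" if xK: "(x, K) \<in> D" for x K
    proof -
      obtain u v where K: "K = cbox u v" using tagged_division_ofD(4)[OF p xK] by blast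
      have x: "x \<in> K" using tagged_division_ofD(2)[OF p xK] .
      have sub: "K \<subseteq> {a..b}" using tagged_division_ofD(3)[OF p xK] .
      have uv: "u \<le> v" "v - u < d" using x small xK K by auto
      have "((\<lambda>y. f x - f y) has_integral (measure lborel K *\<^sub>R f x - integral K f)) (cbox u v)"
        unfolding K using int sub K
        by (intro has_integral_diff has_integral_const integrable_integral integrable_on_subcbox) auto
      moreover have "norm (f x - f y) \<le> e / C" if "y \<in> cbox u v" for y
      proof -
        have "dist x y < d" using that x K uv by (auto simp: dist_real_def)
        then show ?thesis using uc[of y x] that x sub K by (auto simp: dist_norm)
      qed
      ultimately have "norm (measure lborel K *\<^sub>R f x - integral K f) \<le> e / C * measure lborel (cbox u v)"
        using e C by (intro has_integral_bound) auto
      then show ?thesis using K by simp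
    qed
    have "(\<Sum>(x, K)\<in>D. measure lborel K * f x) - integral {a..b} f
        = (\<Sum>(x, K)\<in>D. measure lborel K * f x - integral K f)"
      using integral_combine_tagged_division_topdown[OF int p']
      by (simp add: sum_subtractf split_def)
    also have "\<bar>\<dots>\<bar> \<le> (\<Sum>(x, K)\<in>D. e / C * measure lborel K)"
      using each by (intro order_trans[OF sum_abs] sum_mono) auto
    also have "\<dots> = e / C * measure lborel {a..b}"
      using additive_content_tagged_division[OF p'] unfolding split_def box_real sum_distrib_left[symmetric]
      by (rule arg_cong)
    also have "\<dots> < e" using e C by (simp add: C_def field_simps)
    finally show ?thesis .
  qed
  with d show "\<exists>\<delta>>0. \<forall>D. D tagged_division_of {a..b} \<and> (\<forall>(x, K)\<in>D. measure lborel K < \<delta>) \<longrightarrow>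
        \<bar>(\<Sum>(x, K)\<in>D. measure lborel K * f x) - integral {a..b} f\<bar> < e" by blast
qed

text \<open>Integrability on \<open>{0..1}\<close> settles the end at 0, because the integral
  depends continuously on its lower limit. Continuity on the open half-line makes all proper
  integrals Riemann integrals, so only the limit at infinity remains to be decided.\<close>

lemma improper_riemann_convergent_iff:
  assumes cont: "continuous_on {0<..} f" and int: "f integrable_on {0..1}"
  shows "improper_riemann_convergent f \<longleftrightarrow> (\<exists>M. ((\<lambda>R. integral {1..R} f) \<longlongrightarrow> M) at_top)"
proof
  assume "improper_riemann_convergent f"
  then obtain G M where G: "\<forall>R\<ge>1. has_riemann_integral f 1 R (G R)" "(G \<longlongrightarrow> M) at_top"
    unfolding improper_riemann_convergent_def by blast
  have "eventually (\<lambda>R. G R = integral {1..R} f) at_top"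
    using eventually_ge_at_top[of 1]
    by eventually_elim (use G(1) has_riemann_integral_imp_has_integral integral_unique in metis)
  with G(2) show "\<exists>M. ((\<lambda>R. integral {1..R} f) \<longlongrightarrow> M) at_top"
    by (blast intro: Lim_transform_eventually)
next
  assume "\<exists>M. ((\<lambda>R. integral {1..R} f) \<longlongrightarrow> M) at_top"
  moreover have R: "has_riemann_integral f x y (integral {x..y} f)" if "x > 0" for x y
    using that by (intro continuous_imp_has_riemann_integral continuous_on_subset[OF cont]) auto
  moreover have "((\<lambda>x. integral {x..1} f) \<longlongrightarrow> integral {0..1} f) (at_right 0)"
  proof -
    have "((\<lambda>x. integral {x..1} f) \<longlongrightarrow> integral {0..1} f) (at 0 within {0..1})"
      using indefinite_integral_continuous_1'[OF int] by (auto simp: continuous_on_def)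
    then show ?thesis by (simp add: at_within_Icc_at_right)
  qed
  ultimately show "improper_riemann_convergent f"
    unfolding improper_riemann_convergent_def
    by (intro conjI exI[of _ "\<lambda>x. integral {x..1} f"] exI[of _ "\<lambda>R. integral {1..R} f"]) (auto intro: R)
qed

section \<open>Integrals of powers\<close>

text \<open>Domination by an integrable power makes \<open>h\<close> absolutely integrable on the
  half-line, and the Lebesgue integrals over \<open>{1..R}\<close> then converge. It serves both the
  remainder from integration by parts and the power itself when \<open>a > 1\<close>.\<close>

lemma tendsto_integral_at_top_dominated_powr:
  fixes h :: "real \<Rightarrow> real"
  assumes cont: "continuous_on {1..} h" and p: "p < -1"
    and bound: "\<And>x. x \<ge> 1 \<Longrightarrow> \<bar>h x\<bar> \<le> B * x powr p"
  shows "((\<lambda>R. integral {1..R} h) \<longlongrightarrow> integral {1..} h) at_top"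
proof -
  have "(\<lambda>x. B * x powr p) integrable_on {1..}"
    using has_integral_powr_to_inf[of p 1] p by (intro integrable_on_mult_right) auto
  then have abs: "h absolutely_integrable_on {1..}"
    using cont bound
    by (intro measurable_bounded_by_integrable_imp_absolutely_integrable
          continuous_imp_measurable_on_sets_lebesgue) auto
  have "((\<lambda>R. set_lebesgue_integral lebesgue {1..R} h) \<longlongrightarrow> set_lebesgue_integral lebesgue {1..} h) at_top"
    by (rule tendsto_set_lebesgue_integral_at_top[OF _ abs]) auto
  moreover have "set_lebesgue_integral lebesgue {1..R} h = integral {1..R} h" for R
    by (intro set_lebesgue_integral_eq_integral set_integrable_subset[OF abs]) auto
  moreover have "set_lebesgue_integral lebesgue {1..} h = integral {1..} h"
    by (intro set_lebesgue_integral_eq_integral abs)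
  ultimately show ?thesis by simp
qed

text \<open>Comparison with \<open>1 / x\<close>; this is the source of divergence for even
  exponents.\<close>

lemma ln_le_integral_powr:
  fixes a R :: real
  assumes "a \<le> 1" "R \<ge> 1"
  shows "ln R \<le> integral {1..R} (\<lambda>x. x powr - a)"
proof -
  have "((\<lambda>x. 1 / x) has_integral (ln R - ln 1)) {1..R}"
    using assms
    by (intro fundamental_theorem_of_calculus)
       (auto intro!: derivative_eq_intros simp: has_real_derivative_iff_has_vector_derivative[symmetric])
  moreover have "((\<lambda>x. x powr - a) has_integral integral {1..R} (\<lambda>x. x powr - a)) {1..R}"
    by (intro integrable_integral integrable_continuous_interval continuous_intros) auto
  moreover have "1 / x \<le> x powr - a" if "x \<in> {1..R}" for x
    using powr_mono[of "-1" "-a" x] that assms by (simp add: powr_minus_divide)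
  ultimately have "ln R - ln 1 \<le> integral {1..R} (\<lambda>x. x powr - a)"
    by (rule has_integral_le)
  then show ?thesis by simp
qed

section \<open>Powers of the sine\<close>

text \<open>Induction in steps of two along the reduction formula. Each step multiplies
  \<open>c\<close> by a positive factor, so the values 0 for \<open>n = 1\<close> and 1 for
  \<open>n = 0\<close> determine the sign within each parity class.\<close>

lemma sin_power_decomposition:
  "\<exists>(c::real) P B. (odd n \<longrightarrow> c = 0) \<and> (even n \<longrightarrow> c > 0) \<and>
     (\<forall>x. (P has_real_derivative (sin x ^ n - c)) (at x)) \<and> (\<forall>x. \<bar>P x\<bar> \<le> B)"
proof (induction n rule: induct_nat_012)
  case 0
  show ?case
    by (rule exI[of _ 1], rule exI[of _ "\<lambda>_. 0"], rule exI[of _ 0]) auto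
next
  case 1
  show ?case
    by (rule exI[of _ 0], rule exI[of _ "\<lambda>x. - cos x"], rule exI[of _ 1])
       (auto intro!: derivative_eq_intros)
next
  case (ge2 n)
  then obtain c P B where IH: "odd n \<longrightarrow> c = 0" "even n \<longrightarrow> c > 0"
    "\<And>x. (P has_real_derivative (sin x ^ n - c)) (at x)" "\<And>x. \<bar>P x\<bar> \<le> B" by blast
  \<comment> \<open>The reduction formula writes an antiderivative of \<open>sin x ^ (n + 2)\<close>
    as \<open>k\<close> times one of \<open>sin x ^ n\<close>, minus the bounded term in
    \<open>Q\<close>. Inserting \<open>c * x + P x\<close> for the latter leaves \<open>Q\<close>
    and the new mean \<open>k * c\<close>.\<close>
  define k where "k = (real n + 1) / (real n + 2)"
  define Q where "Q x = k * P x - cos x * sin x ^ (n + 1) / (real n + 2)" for x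
  have "(Q has_real_derivative (sin x ^ (n + 2) - k * c)) (at x)" for x
  proof -
    have "((\<lambda>x. sin x ^ (n + 1)) has_real_derivative (real n + 1) * sin x ^ n * cos x) (at x)"
      using DERIV_power[OF DERIV_sin, of "n + 1" x] by (simp add: algebra_simps)
    note d = DERIV_mult[OF DERIV_cos this]
    have "(Q has_real_derivative k * (sin x ^ n - c)
        - (cos x * ((real n + 1) * sin x ^ n * cos x) - sin x * sin x ^ (n + 1)) / (real n + 2)) (at x)"
      unfolding Q_def[abs_def]
      by (rule DERIV_cong[OF DERIV_diff[OF DERIV_cmult[OF IH(3)] DERIV_cdivide[OF d]]])
         (simp add: algebra_simps)
    also have "cos x * ((real n + 1) * sin x ^ n * cos x)
        = (real n + 1) * sin x ^ n * (1 - (sin x)\<^sup>2)"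
      by (simp add: cos_squared_eq[symmetric] power2_eq_square[of "cos x"])
    also have "k * (sin x ^ n - c)
        - ((real n + 1) * sin x ^ n * (1 - (sin x)\<^sup>2) - sin x * sin x ^ (n + 1)) / (real n + 2)
        = sin x ^ (n + 2) - k * c"
    proof -
      \<comment> \<open>With \<open>m = n + 2\<close>, \<open>s = sin x ^ n\<close> and
        \<open>t = sin x\<close> the claim is a rational identity, free of trigonometry and symbolic
        exponents.\<close>
      have "(m - 1) / m * (s - c) - ((m - 1) * s * (1 - t\<^sup>2) - t * (t * s)) / m
          = t * (t * s) - (m - 1) / m * c" if "m > 0" for m s t :: real
        using that by (simp add: field_simps power2_eq_square)
      from this[of "real n + 2" "sin x ^ n" "sin x"] show ?thesis
        by (simp add: k_def add.commute)
    qed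
    finally show ?thesis .
  qed
  moreover have "\<bar>Q x\<bar> \<le> k * B + 1" for x
  proof -
    have "\<bar>cos x * sin x ^ (n + 1) / (real n + 2)\<bar> \<le> 1 * 1 ^ (n + 1) / 1"
      unfolding abs_divide abs_mult power_abs
      by (intro frac_le mult_mono power_mono) auto
    moreover have "\<bar>k * P x\<bar> \<le> k * B"
      using IH(4)[of x] by (auto simp: abs_mult k_def intro!: mult_left_mono divide_right_mono)
    ultimately show ?thesis unfolding Q_def power_one mult_1 div_by_1 by linarith
  qed
  moreover have "odd (Suc (Suc n)) \<longrightarrow> k * c = 0" "even (Suc (Suc n)) \<longrightarrow> k * c > 0"
    using IH(1,2) by (auto simp: k_def)
  ultimately show ?case
    by (metis add_2_eq_Suc')
qed

lemma integrable_sin_power_div_powr: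
  assumes "b > 0" "a < real b + 1"
  shows "(\<lambda>x. sin x ^ b / x powr a) integrable_on {0..1}"
proof (rule measurable_bounded_by_integrable_imp_integrable)
  show "(\<lambda>x. sin x ^ b / x powr a) \<in> borel_measurable (lebesgue_on {0..1})"
    by (intro measurable_restrict_space1 measurable_completion) simp
  show "(\<lambda>x. x powr (real b - a)) integrable_on {0..1}"
    using assms by (intro integrable_on_powr_from_0) auto
  show "norm (sin x ^ b / x powr a) \<le> x powr (real b - a)" if "x \<in> {0..1}" for x
  \<comment> \<open>At 0 both sides vanish, by the conventions \<open>0 powr y = 0\<close> and
    \<open>y / 0 = 0\<close>.\<close>
  proof (cases "x = 0")
    case False
    with that have "x > 0" by auto
    have "\<bar>sin x\<bar> ^ b \<le> x ^ b"
      using abs_sin_x_le_abs_x[of x] \<open>x > 0\<close> by (intro power_mono) auto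
    then show ?thesis
      using \<open>x > 0\<close> by (simp add: powr_diff powr_realpow power_abs divide_right_mono)
  qed auto
qed auto

text \<open>Integration by parts against the bounded \<open>P\<close>. The statement covers every
  \<open>a > 0\<close> and every \<open>c\<close>, so all cases of the theorem reduce to the
  behaviour of \<open>c\<close> times the integral of a pure power.\<close>

lemma integral_sin_power_asymptotics:
  assumes a: "a > 0"
    and P: "\<And>x. (P has_real_derivative (sin x ^ b - c)) (at x)" "\<And>x. \<bar>P x\<bar> \<le> B"
  shows "\<exists>M. ((\<lambda>R. integral {1..R} (\<lambda>x. sin x ^ b / x powr a)
                  - c * integral {1..R} (\<lambda>x. x powr - a)) \<longlongrightarrow> M) at_top"
proof -
  \<comment> \<open>Up to sign, \<open>q\<close> is the term in which the derivative falls on the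
    power; its exponent lies below -1 exactly because \<open>a > 0\<close>.\<close>
  define q where "q x = a * P x * x powr (- a - 1)" for x
  have contP: "continuous_on S P" for S
    using P(1) DERIV_isCont continuous_at_imp_continuous_on by blast
  have contq: "continuous_on {1..} q"
    unfolding q_def by (intro continuous_intros contP) auto
  have "((\<lambda>R. integral {1..R} q) \<longlongrightarrow> integral {1..} q) at_top"
  proof (rule tendsto_integral_at_top_dominated_powr[OF contq])
    show "- a - 1 < -1" using a by simp
    show "\<bar>q x\<bar> \<le> a * B * x powr (- a - 1)" for x
      unfolding q_def using a P(2)[of x] by (auto simp: abs_mult intro!: mult_left_mono mult_right_mono)
  qed
  moreover have "((\<lambda>R. P R * R powr - a) \<longlongrightarrow> 0) at_top"
  proof (rule Lim_null_comparison)
    show "((\<lambda>R. B * R powr - a) \<longlongrightarrow> 0) at_top"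
      using a by (intro tendsto_mult_right_zero tendsto_neg_powr filterlim_ident) auto
    show "eventually (\<lambda>R. norm (P R * R powr - a) \<le> B * R powr - a) at_top"
      using P(2) by (intro always_eventually) (auto simp: abs_mult intro!: mult_right_mono)
  qed
  ultimately have "((\<lambda>R. P R * R powr - a - P 1 + integral {1..R} q) \<longlongrightarrow> 0 - P 1 + integral {1..} q) at_top"
    by (intro tendsto_intros)
  moreover have "eventually (\<lambda>R. P R * R powr - a - P 1 + integral {1..R} q
      = integral {1..R} (\<lambda>x. sin x ^ b / x powr a) - c * integral {1..R} (\<lambda>x. x powr - a)) at_top"
    using eventually_ge_at_top[of 1]
  proof eventually_elim
    case (elim R)
    have "((\<lambda>x. (sin x ^ b - c) * x powr - a - q x) has_integral
          (P R * R powr - a - P 1 * 1 powr - a)) {1..R}"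
    proof (rule fundamental_theorem_of_calculus[OF elim])
      fix x assume x: "x \<in> {1..R}"
      have "((\<lambda>x. P x * x powr - a) has_real_derivative (sin x ^ b - c) * x powr - a - q x) (at x)"
        unfolding q_def using x by (auto intro!: derivative_eq_intros P(1))
      then show "((\<lambda>x. P x * x powr - a) has_vector_derivative (sin x ^ b - c) * x powr - a - q x) 
          (at x within {1..R})"
        by (simp add: has_field_derivative_at_within flip: has_real_derivative_iff_has_vector_derivative)
    qed
    moreover have "(q has_integral integral {1..R} q) {1..R}"
      by (intro integrable_integral integrable_continuous_interval continuous_on_subset[OF contq]) auto
    moreover have "((\<lambda>x. c * x powr - a) has_integral c * integral {1..R} (\<lambda>x. x powr - a)) {1..R}"
      by (intro has_integral_mult_right integrable_integral integrable_continuous_interval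
            continuous_intros) auto
    \<comment> \<open>Adding back \<open>q\<close> and the mean part turns the exact derivative of
      \<open>P x * x powr - a\<close> into the original integrand.\<close>
    ultimately have "((\<lambda>x. ((sin x ^ b - c) * x powr - a - q x) + q x + c * x powr - a) has_integral
        (P R * R powr - a - P 1 * 1 powr - a) + integral {1..R} q + c * integral {1..R} (\<lambda>x. x powr - a)) {1..R}"
      by (intro has_integral_add)
    moreover have "((sin x ^ b - c) * x powr - a - q x) + q x + c * x powr - a = sin x ^ b / x powr a" for x
      by (simp add: algebra_simps powr_minus_divide)
    ultimately show ?case by (simp add: integral_unique)
  qed
  ultimately show ?thesis by (blast intro: Lim_transform_eventually)
qed

theorem mainTheorem1:
  fixes a :: real and b :: nat
  assumes "b > 0" and "0 < a" and "a < real b + 1"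
  shows "(a > 1 \<longrightarrow> improper_riemann_convergent (\<lambda>x. sin x ^ b / x powr a)) \<and>
         (a \<le> 1 \<longrightarrow>
            (odd b \<longrightarrow> improper_riemann_convergent (\<lambda>x. sin x ^ b / x powr a)) \<and>
            (even b \<longrightarrow> improper_riemann_divergent (\<lambda>x. sin x ^ b / x powr a)))"
proof -
  let ?f = "\<lambda>x::real. sin x ^ b / x powr a"
  let ?J = "\<lambda>R. integral {1..R} (\<lambda>x::real. x powr - a)"
  have conv_iff: "improper_riemann_convergent ?f \<longleftrightarrow> (\<exists>M. ((\<lambda>R. integral {1..R} ?f) \<longlongrightarrow> M) at_top)"
    using assms
    by (intro improper_riemann_convergent_iff integrable_sin_power_div_powr continuous_intros) auto
  obtain c P B where c: "odd b \<longrightarrow> c = 0" "even b \<longrightarrow> c > 0"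
    and P: "\<And>x. (P has_real_derivative (sin x ^ b - c)) (at x)" "\<And>x. \<bar>P x\<bar> \<le> B"
    using sin_power_decomposition[of b] by blast
  obtain M where M: "((\<lambda>R. integral {1..R} ?f - c * ?J R) \<longlongrightarrow> M) at_top"
    using integral_sin_power_asymptotics[OF \<open>0 < a\<close> P] by blast
  \<comment> \<open>The difference from \<open>c * ?J\<close> always converges, so convergence of
    \<open>c * ?J\<close> suffices.\<close>
  have conv: "improper_riemann_convergent ?f" if "((\<lambda>R. c * ?J R) \<longlongrightarrow> N) at_top" for N
    using tendsto_add[OF M that] conv_iff by auto
  have "improper_riemann_convergent ?f" if "a > 1"
  proof (rule conv)
    have "(?J \<longlongrightarrow> integral {1..} (\<lambda>x. x powr - a)) at_top"
      using that
      by (intro tendsto_integral_at_top_dominated_powr[where p = "- a" and B = 1] continuous_intros) auto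
    then show "((\<lambda>R. c * ?J R) \<longlongrightarrow> c * integral {1..} (\<lambda>x. x powr - a)) at_top"
      by (intro tendsto_intros)
  qed
  moreover have "improper_riemann_convergent ?f" if "odd b"
    \<comment> \<open>Here \<open>c = 0\<close>, so \<open>c * ?J\<close> vanishes identically,
      whatever the growth of \<open>?J\<close>.\<close>
    using conv[of 0] c(1) that by simp
  moreover have "\<not> improper_riemann_convergent ?f" if "even b" "a \<le> 1"
  proof
    assume "improper_riemann_convergent ?f"
    then obtain L where "((\<lambda>R. integral {1..R} ?f) \<longlongrightarrow> L) at_top"
      using conv_iff by blast
    \<comment> \<open>Convergence would force \<open>c * ?J\<close> to converge and, as
      \<open>c > 0\<close>, also \<open>?J\<close>, which however dominates the logarithm.\<close>
    from tendsto_diff[OF this M] have "((\<lambda>R. c * ?J R) \<longlongrightarrow> L - M) at_top" by simp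
    then have "((\<lambda>R. inverse c * (c * ?J R)) \<longlongrightarrow> inverse c * (L - M)) at_top"
      by (intro tendsto_intros)
    moreover have "inverse c * (c * y) = y" for y using c(2) \<open>even b\<close> by simp
    ultimately have "(?J \<longlongrightarrow> inverse c * (L - M)) at_top" by simp
    moreover have "filterlim ?J at_top at_top"
    proof (rule filterlim_at_top_mono[OF ln_at_top])
      show "eventually (\<lambda>R. ln R \<le> ?J R) at_top"
        using eventually_ge_at_top[of 1] by eventually_elim (use ln_le_integral_powr that in auto)
    qed
    ultimately show False
      using not_tendsto_and_filterlim_at_infinity filterlim_at_top_imp_at_infinity
        trivial_limit_at_top_linorder by blast
  qed
  ultimately show ?thesis by blast
qed

end
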